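(* Let $(L,A,\cdot,\ell)$ be a left-symmetric Rinehart algebra over a field $\mathbb K$ of characteristic zero, $(M;\rho,\mu)$ a representation of it, and $T_1,T_2:M\to L$ two $\mathcal O$-operators on $(L,A,\cdot,\ell)$ associated to $(M;\rho,\mu)$. Suppose that $T_2$ is invertible. If $T_1$ and $T_2$ are compatible, then $N=T_1\circ T_2^{-1}$ is a Nijenhuis operator on $(L,A,\cdot,\ell)$.
   Context: All vector spaces are over a field $\mathbb K$ of characteristic zero. A left-symmetric Rinehart algebra is a quadruple $(L,A,\cdot,\ell)$ where $A$ is an associative commutative $\mathbb K$-algebra, $L$ is an $A$-module with a bilinear product satisfying $(x\cdot y)\cdot z-x\cdot(y\cdot z)=(y\cdot x)\cdot z-y\cdot(x\cdot z)$, and $\ell:L\to \mathrm{Der}(A)$ is a linear map such that $\ell(x\cdot y-y\cdot x)=\ell(x)\ell(y)-\ell(y)\ell(x)$, $\ell(ax)=a\ell(x)$, $x\cdot(ay)=\ell(x)(a)\,y+a(x\cdot y)$, and $(ax)\cdot y=a(x\cdot y)$ for all $a\in A$, $x,y,z\in L$. Write $[x,y]=x\cdot y-y\cdot x$. A representation $(M;\rho,\mu)$ of $(L,A,\cdot,\ell)$ consists of an $A$-module $M$, a linear map $\rho:L\to\mathrm{End}_{\mathbb K}(M)$ with $\rho([x,y])=\rho(x)\rho(y)-\rho(y)\rho(x)$, $\rho(ax)m=a\rho(x)m$, $\rho(x)(am)=a\rho(x)m+\ell(x)(a)m$, and a linear map $\mu:L\to \mathrm{End}_{\mathbb K}(M)$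 with $\mu(ax)m=a\mu(x)m=\mu(x)(am)$ and $\rho(x)\mu(y)-\mu(y)\rho(x)=\mu(x\cdot y)-\mu(y)\mu(x)$. An $\mathcal O$-operator associated to $(M;\rho,\mu)$ is a linear map $T:M\to L$ with $T(au)=aT(u)$ and $T(u)\cdot T(v)=T(\rho(T(u))(v)+\mu(T(v))(u))$ for all $u,v\in M$, $a\in A$. Two $\mathcal O$-operators $T_1,T_2$ associated to $(M;\rho,\mu)$ are compatible if $T_1+T_2$ is an $\mathcal O$-operator associated to $(M;\rho,\mu)$. A Nijenhuis operator on $(L,A,\cdot,\ell)$ is an $A$-linear map $N:L\to L$ with $N(x)\cdot N(y)-N(x\cdot N(y))-N(N(x)\cdot y)+N^2(x\cdot y)=0$ for all $x,y\in L$. *)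

theory Defs
  imports Complex_Main
begin

text \<open>
  Carriers are types. The ground field is a type of class \<^class>\<open>field_char_0\<close>; each
  \<open>\<K>\<close>-vector space is an abelian group type together with a scalar multiplication
  \<open>s\<^sub>A\<close>, \<open>s\<^sub>L\<close>, \<open>s\<^sub>M\<close> satisfying \<^locale>\<open>vector_space\<close>. The algebra \<open>A\<close> is not required to be
  unital (class \<^class>\<open>comm_ring\<close>), and its modules are not required to satisfy \<open>1x = x\<close>;
  unital algebras and unital modules are a special case.
\<close>

locale comm_assoc_algebra = vector_space s\<^sub>A
  for s\<^sub>A :: "'k::field_char_0 \<Rightarrow> 'a::comm_ring \<Rightarrow> 'a" +
  assumes scale_mult: "s\<^sub>A c (a * b) = s\<^sub>A c a * b"

text \<open>
  The library's \<^locale>\<open>module\<close> needs a unital ring of scalars. The last two axioms say that the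
  \<open>A\<close>-action is \<open>\<K>\<close>-bilinear.
\<close>

locale algebra_module =
  A: comm_assoc_algebra s\<^sub>A + V: vector_space s\<^sub>V
  for s\<^sub>A :: "'k::field_char_0 \<Rightarrow> 'a::comm_ring \<Rightarrow> 'a"
    and s\<^sub>V :: "'k \<Rightarrow> 'v::ab_group_add \<Rightarrow> 'v"
    and act :: "'a \<Rightarrow> 'v \<Rightarrow> 'v" +
  assumes act_add_right: "act a (x + y) = act a x + act a y"
    and act_add_left: "act (a + b) x = act a x + act b x"
    and act_act: "act a (act b x) = act (a * b) x"
    and act_scale_left: "act (s\<^sub>A c a) x = s\<^sub>V c (act a x)"
    and act_scale_right: "act a (s\<^sub>V c x) = s\<^sub>V c (act a x)"

definition End_K :: "('k::field_char_0 \<Rightarrow> 'v::ab_group_add \<Rightarrow> 'v) \<Rightarrow> ('v \<Rightarrow> 'v) set"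
  where "End_K s = {f. Vector_Spaces.linear s s f}"

definition Der :: "('k::field_char_0 \<Rightarrow> 'a::comm_ring \<Rightarrow> 'a) \<Rightarrow> ('a \<Rightarrow> 'a) set"
  where "Der s\<^sub>A = {D \<in> End_K s\<^sub>A. \<forall>a b. D (a * b) = D a * b + a * D b}"

text \<open>
  Linearity of a map \<open>f\<close> from a vector space into \<open>End_K s\<^sub>V\<close> (or its subspace \<open>Der s\<^sub>V\<close>), whose
  vector space operations are pointwise.
\<close>

definition linear_into_End ::
  "('k::field_char_0 \<Rightarrow> 'u::ab_group_add \<Rightarrow> 'u) \<Rightarrow> ('k \<Rightarrow> 'v::ab_group_add \<Rightarrow> 'v)
    \<Rightarrow> ('u \<Rightarrow> 'v \<Rightarrow> 'v) \<Rightarrow> bool"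
  where "linear_into_End s\<^sub>U s\<^sub>V f \<longleftrightarrow>
    (\<forall>x. f x \<in> End_K s\<^sub>V) \<and> (\<forall>v. Vector_Spaces.linear s\<^sub>U s\<^sub>V (\<lambda>x. f x v))"

locale left_symmetric_Rinehart_algebra =
  algebra_module s\<^sub>A s\<^sub>L act\<^sub>L
  for s\<^sub>A :: "'k::field_char_0 \<Rightarrow> 'a::comm_ring \<Rightarrow> 'a"
    and s\<^sub>L :: "'k \<Rightarrow> 'l::ab_group_add \<Rightarrow> 'l"
    and act\<^sub>L :: "'a \<Rightarrow> 'l \<Rightarrow> 'l"
    and mul :: "'l \<Rightarrow> 'l \<Rightarrow> 'l"
    and ell :: "'l \<Rightarrow> 'a \<Rightarrow> 'a" +
  assumes mul_linear_right: "Vector_Spaces.linear s\<^sub>L s\<^sub>L (\<lambda>y. mul x y)"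
    and mul_linear_left: "Vector_Spaces.linear s\<^sub>L s\<^sub>L (\<lambda>x. mul x y)"
    and left_symmetric:
      "mul (mul x y) z - mul x (mul y z) = mul (mul y x) z - mul y (mul x z)"
    and ell_Der: "ell x \<in> Der s\<^sub>A"
    and ell_linear: "linear_into_End s\<^sub>L s\<^sub>A ell"
    and ell_bracket: "ell (mul x y - mul y x) a = ell x (ell y a) - ell y (ell x a)"
    and ell_act: "ell (act\<^sub>L a x) b = a * ell x b"
    and mul_act_right: "mul x (act\<^sub>L a y) = act\<^sub>L (ell x a) y + act\<^sub>L a (mul x y)"
    and mul_act_left: "mul (act\<^sub>L a x) y = act\<^sub>L a (mul x y)"

locale lsr_representation =
  L: left_symmetric_Rinehart_algebra s\<^sub>A s\<^sub>L act\<^sub>L mul ell + M: algebra_module s\<^sub>A s\<^sub>M act\<^sub>M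
  for s\<^sub>A :: "'k::field_char_0 \<Rightarrow> 'a::comm_ring \<Rightarrow> 'a"
    and s\<^sub>L :: "'k \<Rightarrow> 'l::ab_group_add \<Rightarrow> 'l"
    and act\<^sub>L :: "'a \<Rightarrow> 'l \<Rightarrow> 'l"
    and mul :: "'l \<Rightarrow> 'l \<Rightarrow> 'l"
    and ell :: "'l \<Rightarrow> 'a \<Rightarrow> 'a"
    and s\<^sub>M :: "'k \<Rightarrow> 'm::ab_group_add \<Rightarrow> 'm"
    and act\<^sub>M :: "'a \<Rightarrow> 'm \<Rightarrow> 'm"
    and \<rho> :: "'l \<Rightarrow> 'm \<Rightarrow> 'm"
    and \<mu> :: "'l \<Rightarrow> 'm \<Rightarrow> 'm" +
  assumes rho_linear: "linear_into_End s\<^sub>L s\<^sub>M \<rho>"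
    and rho_bracket: "\<rho> (mul x y - mul y x) m = \<rho> x (\<rho> y m) - \<rho> y (\<rho> x m)"
    and rho_act_left: "\<rho> (act\<^sub>L a x) m = act\<^sub>M a (\<rho> x m)"
    and rho_act_right: "\<rho> x (act\<^sub>M a m) = act\<^sub>M a (\<rho> x m) + act\<^sub>M (ell x a) m"
    and mu_linear: "linear_into_End s\<^sub>L s\<^sub>M \<mu>"
    and mu_act_left: "\<mu> (act\<^sub>L a x) m = act\<^sub>M a (\<mu> x m)"
    and mu_act_right: "\<mu> x (act\<^sub>M a m) = act\<^sub>M a (\<mu> x m)"
    and rho_mu: "\<rho> x (\<mu> y m) - \<mu> y (\<rho> x m) = \<mu> (mul x y) m - \<mu> y (\<mu> x m)"

text \<open>
  As \<open>A\<close> need not have a unit, \<open>\<K>\<close>-linearity does not follow from \<open>A\<close>-equivariance and is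
  part of \<open>A\<close>-linearity.
\<close>

definition A_linear ::
  "('k::field_char_0 \<Rightarrow> 'u::ab_group_add \<Rightarrow> 'u) \<Rightarrow> ('a::comm_ring \<Rightarrow> 'u \<Rightarrow> 'u)
    \<Rightarrow> ('k \<Rightarrow> 'v::ab_group_add \<Rightarrow> 'v) \<Rightarrow> ('a \<Rightarrow> 'v \<Rightarrow> 'v) \<Rightarrow> ('u \<Rightarrow> 'v) \<Rightarrow> bool"
  where "A_linear s\<^sub>U act\<^sub>U s\<^sub>V act\<^sub>V f \<longleftrightarrow>
    Vector_Spaces.linear s\<^sub>U s\<^sub>V f \<and> (\<forall>a u. f (act\<^sub>U a u) = act\<^sub>V a (f u))"

context lsr_representation
begin

definition O_operator :: "('m \<Rightarrow> 'l) \<Rightarrow> bool"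
  where "O_operator T \<longleftrightarrow> A_linear s\<^sub>M act\<^sub>M s\<^sub>L act\<^sub>L T \<and>
    (\<forall>u v. mul (T u) (T v) = T (\<rho> (T u) v + \<mu> (T v) u))"

definition compatible :: "('m \<Rightarrow> 'l) \<Rightarrow> ('m \<Rightarrow> 'l) \<Rightarrow> bool"
  where "compatible T\<^sub>1 T\<^sub>2 \<longleftrightarrow>
    O_operator T\<^sub>1 \<and> O_operator T\<^sub>2 \<and> O_operator (\<lambda>u. T\<^sub>1 u + T\<^sub>2 u)"

end

context left_symmetric_Rinehart_algebra
begin

definition Nijenhuis_operator :: "('l \<Rightarrow> 'l) \<Rightarrow> bool"
  where "Nijenhuis_operator N \<longleftrightarrow> A_linear s\<^sub>L act\<^sub>L s\<^sub>L act\<^sub>L N \<and>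
    (\<forall>x y. mul (N x) (N y) - N (mul x (N y)) - N (mul (N x) y) + N (N (mul x y)) = 0)"

end

end

theory Submission
  imports Defs
begin

text \<open>
  Expanding the identity for the O-operator \<open>T\<^sub>1 + T\<^sub>2\<close> and cancelling those for \<open>T\<^sub>1\<close> and \<open>T\<^sub>2\<close>
  leaves the mixed terms
  \<open>T\<^sub>1 u \<cdot> T\<^sub>2 v + T\<^sub>2 u \<cdot> T\<^sub>1 v = T\<^sub>1 w\<^sub>2 + T\<^sub>2 w\<^sub>1\<close>, where \<open>w\<^sub>i = \<rho> (T\<^sub>i u) v + \<mu> (T\<^sub>i v) u\<close>.
  Since \<open>N T\<^sub>2 = T\<^sub>1\<close>, applying \<open>N\<close> gives the Nijenhuis identity at \<open>x = T\<^sub>2 u\<close>, \<open>y = T\<^sub>2 v\<close>,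
  because \<open>T\<^sub>1 w\<^sub>1 = T\<^sub>1 u \<cdot> T\<^sub>1 v\<close> and \<open>T\<^sub>2 w\<^sub>2 = T\<^sub>2 u \<cdot> T\<^sub>2 v\<close>.
\<close>

lemma A_linear_comp:
  assumes "A_linear s\<^sub>U act\<^sub>U s\<^sub>V act\<^sub>V f" "A_linear s\<^sub>V act\<^sub>V s\<^sub>W act\<^sub>W g"
  shows "A_linear s\<^sub>U act\<^sub>U s\<^sub>W act\<^sub>W (g \<circ> f)"
  using assms unfolding A_linear_def by (auto intro: Vector_Spaces.linear_compose)

lemma A_linear_inv:
  assumes f: "A_linear s\<^sub>U act\<^sub>U s\<^sub>V act\<^sub>V f" and "bij f"
  shows "A_linear s\<^sub>V act\<^sub>V s\<^sub>U act\<^sub>U (inv f)"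
proof -
  interpret f: Vector_Spaces.linear s\<^sub>U s\<^sub>V f
    using f by (simp add: A_linear_def)
  have finv: "f (inv f y) = y" for y
    using \<open>bij f\<close> by (simp add: bij_is_surj surj_f_inv_f)
  \<comment> \<open>By injectivity, each law for \<open>inv f\<close> may be checked after applying
    \<open>f\<close>, where \<open>finv\<close> cancels the inverse.\<close>
  have invI: "inv f y = x" if "y = f x" for x y
    using that \<open>bij f\<close> by (simp add: bij_is_inj)
  have "inv f (x + y) = inv f x + inv f y" for x y
    by (rule invI) (simp add: f.add finv)
  moreover have "inv f (s\<^sub>V c x) = s\<^sub>U c (inv f x)" for c x
    by (rule invI) (simp add: f.scale finv)
  ultimately have "Vector_Spaces.linear s\<^sub>V s\<^sub>U (inv f)"
    by unfold_locales auto
  moreover have "inv f (act\<^sub>V a x) = act\<^sub>U a (inv f x)" for a x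
    using f by (intro invI) (simp add: A_linear_def finv)
  ultimately show ?thesis
    by (simp add: A_linear_def)
qed

context lsr_representation
begin

text \<open>The O-operator identity is homogeneous quadratic in the operator; this is its
  polarization.\<close>

lemma compatible_mixed:
  assumes "compatible T\<^sub>1 T\<^sub>2"
  shows "mul (T\<^sub>1 u) (T\<^sub>2 v) + mul (T\<^sub>2 u) (T\<^sub>1 v)
    = T\<^sub>1 (\<rho> (T\<^sub>2 u) v + \<mu> (T\<^sub>2 v) u) + T\<^sub>2 (\<rho> (T\<^sub>1 u) v + \<mu> (T\<^sub>1 v) u)"
proof -
  have O1: "O_operator T\<^sub>1" and O2: "O_operator T\<^sub>2" and O12: "O_operator (\<lambda>u. T\<^sub>1 u + T\<^sub>2 u)"
    using assms by (auto simp: compatible_def)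
  interpret T1: Vector_Spaces.linear s\<^sub>M s\<^sub>L T\<^sub>1 using O1 by (simp add: O_operator_def A_linear_def)
  interpret T2: Vector_Spaces.linear s\<^sub>M s\<^sub>L T\<^sub>2 using O2 by (simp add: O_operator_def A_linear_def)
  have mul_add: "mul x (y + z) = mul x y + mul x z" "mul (x + y) z = mul x z + mul y z" for x y z
    using Vector_Spaces.linear.axioms(3)[OF L.mul_linear_right] Vector_Spaces.linear.axioms(3)[OF L.mul_linear_left]
    by (auto dest: module_hom.add)
  \<comment> \<open>Additivity in the \<open>L\<close> argument at fixed \<open>m\<close> is the
    second conjunct of \<open>linear_into_End\<close>; it splits the inner occurrences of the sum
    operator.\<close>
  have map_add: "\<rho> (x + y) m = \<rho> x m + \<rho> y m" "\<mu> (x + y) m = \<mu> x m + \<mu> y m" for x y m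
    using rho_linear mu_linear
    unfolding linear_into_End_def by (metis Vector_Spaces.linear.axioms(3) module_hom.add)+
  have "mul (T\<^sub>1 u) (T\<^sub>1 v) = T\<^sub>1 (\<rho> (T\<^sub>1 u) v + \<mu> (T\<^sub>1 v) u)"
    using O1 by (simp add: O_operator_def)
  moreover have "mul (T\<^sub>2 u) (T\<^sub>2 v) = T\<^sub>2 (\<rho> (T\<^sub>2 u) v + \<mu> (T\<^sub>2 v) u)"
    using O2 by (simp add: O_operator_def)
  moreover have "mul (T\<^sub>1 u + T\<^sub>2 u) (T\<^sub>1 v + T\<^sub>2 v)
      = T\<^sub>1 (\<rho> (T\<^sub>1 u + T\<^sub>2 u) v + \<mu> (T\<^sub>1 v + T\<^sub>2 v) u)
      + T\<^sub>2 (\<rho> (T\<^sub>1 u + T\<^sub>2 u) v + \<mu> (T\<^sub>1 v + T\<^sub>2 v) u)"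
    using O12 by (simp add: O_operator_def)
  ultimately show ?thesis
    by (simp add: mul_add map_add T1.add T2.add algebra_simps)
qed

lemma Nijenhuis_operator_of_compatible:
  assumes compat: "compatible T\<^sub>1 T\<^sub>2" and "bij T\<^sub>2"
  shows "L.Nijenhuis_operator (T\<^sub>1 \<circ> inv T\<^sub>2)"
proof -
  define N where "N = T\<^sub>1 \<circ> inv T\<^sub>2"
  have O1: "O_operator T\<^sub>1" and O2: "O_operator T\<^sub>2"
    using compat by (auto simp: compatible_def)
  have N_lin: "A_linear s\<^sub>L act\<^sub>L s\<^sub>L act\<^sub>L N"
    unfolding N_def using O1 O2 \<open>bij T\<^sub>2\<close>
    by (auto simp: O_operator_def intro: A_linear_comp A_linear_inv)
  interpret N: Vector_Spaces.linear s\<^sub>L s\<^sub>L N using N_lin by (simp add: A_linear_def)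
  have N_T2: "N (T\<^sub>2 w) = T\<^sub>1 w" for w
    using \<open>bij T\<^sub>2\<close> by (simp add: N_def bij_is_inj)
  have "mul (N x) (N y) - N (mul x (N y)) - N (mul (N x) y) + N (N (mul x y)) = 0" for x y
  proof -
    \<comment> \<open>Surjectivity of \<open>T\<^sub>2\<close> supplies \<open>u\<close> and
      \<open>v\<close>; by \<open>N_T2\<close>, \<open>N x\<close> and \<open>N y\<close> become
      \<open>T\<^sub>1 u\<close> and \<open>T\<^sub>1 v\<close>.\<close>
    obtain u v where x: "x = T\<^sub>2 u" and y: "y = T\<^sub>2 v"
      using \<open>bij T\<^sub>2\<close> by (metis bij_pointE)
    define w\<^sub>1 w\<^sub>2 where "w\<^sub>1 = \<rho> (T\<^sub>1 u) v + \<mu> (T\<^sub>1 v) u" and "w\<^sub>2 = \<rho> (T\<^sub>2 u) v + \<mu> (T\<^sub>2 v) u"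
    have w1: "mul (T\<^sub>1 u) (T\<^sub>1 v) = T\<^sub>1 w\<^sub>1" and w2: "mul (T\<^sub>2 u) (T\<^sub>2 v) = T\<^sub>2 w\<^sub>2"
      using O1 O2 by (simp_all add: O_operator_def w\<^sub>1_def w\<^sub>2_def)
    \<comment> \<open>The left-hand summands are \<open>N (mul (N x) y)\<close> and
      \<open>N (mul x (N y))\<close>.\<close>
    have "N (mul (T\<^sub>1 u) (T\<^sub>2 v)) + N (mul (T\<^sub>2 u) (T\<^sub>1 v)) = N (T\<^sub>1 w\<^sub>2 + T\<^sub>2 w\<^sub>1)"
      using compatible_mixed[OF compat, of u v] by (simp add: w\<^sub>1_def w\<^sub>2_def flip: N.add)
    also have "\<dots> = N (T\<^sub>1 w\<^sub>2) + T\<^sub>1 w\<^sub>1"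
      by (simp add: N.add N_T2)
    \<comment> \<open>Here
      \<open>T\<^sub>1 w\<^sub>2 = N (T\<^sub>2 w\<^sub>2) = N (mul x y)\<close>, so
      \<open>N (T\<^sub>1 w\<^sub>2)\<close> is the term with \<open>N\<close> squared.\<close>
    finally show ?thesis
      by (simp add: x y N_T2 w1 w2 algebra_simps)
  qed
  then show ?thesis
    using N_lin by (simp add: L.Nijenhuis_operator_def N_def)
qed

end

theorem proposition7p9:
  fixes s\<^sub>A :: "'k::field_char_0 \<Rightarrow> 'a::comm_ring \<Rightarrow> 'a"
    and s\<^sub>L :: "'k \<Rightarrow> 'l::ab_group_add \<Rightarrow> 'l"
    and act\<^sub>L :: "'a \<Rightarrow> 'l \<Rightarrow> 'l"
    and mul :: "'l \<Rightarrow> 'l \<Rightarrow> 'l"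
    and ell :: "'l \<Rightarrow> 'a \<Rightarrow> 'a"
    and s\<^sub>M :: "'k \<Rightarrow> 'm::ab_group_add \<Rightarrow> 'm"
    and act\<^sub>M :: "'a \<Rightarrow> 'm \<Rightarrow> 'm"
    and \<rho> \<mu> :: "'l \<Rightarrow> 'm \<Rightarrow> 'm"
    and T\<^sub>1 T\<^sub>2 :: "'m \<Rightarrow> 'l"
  assumes "left_symmetric_Rinehart_algebra s\<^sub>A s\<^sub>L act\<^sub>L mul ell"
    and "lsr_representation s\<^sub>A s\<^sub>L act\<^sub>L mul ell s\<^sub>M act\<^sub>M \<rho> \<mu>"
    and "lsr_representation.O_operator s\<^sub>L act\<^sub>L mul s\<^sub>M act\<^sub>M \<rho> \<mu> T\<^sub>1"
    and "lsr_representation.O_operator s\<^sub>L act\<^sub>L mul s\<^sub>M act\<^sub>M \<rho> \<mu> T\<^sub>2"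
    and "bij T\<^sub>2"
    and "lsr_representation.compatible s\<^sub>L act\<^sub>L mul s\<^sub>M act\<^sub>M \<rho> \<mu> T\<^sub>1 T\<^sub>2"
  shows "left_symmetric_Rinehart_algebra.Nijenhuis_operator s\<^sub>L act\<^sub>L mul (T\<^sub>1 \<circ> inv T\<^sub>2)"
  using assms lsr_representation.Nijenhuis_operator_of_compatible by blast

end
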